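(* For any positive integers $t$ and $h$, there is a graph with treewidth $t$ and pathwidth at least $t(h+1)-1$ that contains no subdivision of a complete binary tree of height $3\max(h+1,\lceil\log_2 t\rceil)$.
   Context: Graphs are finite, simple and undirected. A complete binary tree of height $c$ is a rooted tree in which every non-leaf node has two children and every root-to-leaf path has $c$ edges; a subdivision of a tree is obtained by replacing each edge $uv$ by a path from $u$ to $v$ whose internal vertices are new and private to that path. "Contains" means as a subgraph. *)

theory Defs
  imports Complex_Main "Graph_Theory.Graph_Theory"
begin

text \<open>
  Finite simple undirected graphs are the symmetric loop-free digraphs of the locale
  \<^locale>\<open>pair_graph\<close>. The library constant \<^const>\<open>tree\<close> cannot be used for them: the walk
  \<open>u, v, u\<close> along a single edge counts as a \<^const>\<open>pre_digraph.cycle\<close> of a symmetric digraph.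
  In a loop-free graph, the cycles of length at least 3 are exactly the undirected cycles.
\<close>

definition undirected_tree :: "'a pair_pre_digraph \<Rightarrow> bool" where
  "undirected_tree T \<longleftrightarrow> pair_graph T \<and> Digraph_Component.connected (with_proj T) \<and>
     \<not> (\<exists>p. pre_digraph.cycle (with_proj T) p \<and> 3 \<le> length p)"

definition path_graph :: "'a pair_pre_digraph \<Rightarrow> bool" where
  "path_graph P \<longleftrightarrow> (\<exists>xs. xs \<noteq> [] \<and> distinct xs \<and> pverts P = set xs \<and>
     parcs P = set (vwalk_arcs xs) \<union> (set (vwalk_arcs xs))\<inverse>)"


section \<open>Treewidth and pathwidth\<close>

text \<open>
  \<^const>\<open>Digraph_Component.connected\<close> includes non-emptiness, so the last condition also says
  that every vertex of \<open>G\<close> lies in some bag.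
\<close>

definition tree_decomposition ::
    "'a pair_pre_digraph \<Rightarrow> 'n pair_pre_digraph \<Rightarrow> ('n \<Rightarrow> 'a set) \<Rightarrow> bool" where
  "tree_decomposition G T B \<longleftrightarrow> undirected_tree T \<and>
     (\<forall>x\<in>pverts T. B x \<subseteq> pverts G) \<and>
     (\<forall>(u, v)\<in>parcs G. \<exists>x\<in>pverts T. u \<in> B x \<and> v \<in> B x) \<and>
     (\<forall>v\<in>pverts G. Digraph_Component.connected (with_proj T \<restriction> {x \<in> pverts T. v \<in> B x}))"

definition path_decomposition ::
    "'a pair_pre_digraph \<Rightarrow> 'n pair_pre_digraph \<Rightarrow> ('n \<Rightarrow> 'a set) \<Rightarrow> bool" where
  "path_decomposition G P B \<longleftrightarrow> path_graph P \<and> tree_decomposition G P B"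

definition decomposition_width :: "'n pair_pre_digraph \<Rightarrow> ('n \<Rightarrow> 'a set) \<Rightarrow> nat" where
  "decomposition_width T B = Max ((\<lambda>x. card (B x)) ` pverts T) - 1"

text \<open>
  As decomposition trees are finite, it is no restriction to take their nodes from \<^typ>\<open>nat\<close>.
  A finite graph has a decomposition with a single bag, so both infima are minima. Because of
  the truncated subtraction the null graph gets width 0 instead of -1.
\<close>

definition treewidth :: "'a pair_pre_digraph \<Rightarrow> nat" where
  "treewidth G = Inf {decomposition_width T B | (T :: nat pair_pre_digraph) B.
     tree_decomposition G T B}"

definition pathwidth :: "'a pair_pre_digraph \<Rightarrow> nat" where
  "pathwidth G = Inf {decomposition_width P B | (P :: nat pair_pre_digraph) B.
     path_decomposition G P B}"


section \<open>Complete binary trees and their subdivisions\<close>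

text \<open>
  In the tree \<open>T\<close> rooted at \<open>r\<close>, the children of \<open>v\<close> are the vertices \<open>w\<close> for which the path
  from \<open>r\<close> to \<open>w\<close> ends with the edge \<open>vw\<close>.
\<close>

definition children :: "'a pair_pre_digraph \<Rightarrow> 'a \<Rightarrow> 'a \<Rightarrow> 'a set" where
  "children T r v = {w. \<exists>p. pre_digraph.apath (with_proj T) r (p @ [(v, w)]) w}"

definition complete_binary_tree :: "nat \<Rightarrow> 'a pair_pre_digraph \<Rightarrow> bool" where
  "complete_binary_tree c T \<longleftrightarrow> undirected_tree T \<and>
     (\<exists>r\<in>pverts T. \<forall>v\<in>pverts T.
        (children T r v \<noteq> {} \<longrightarrow> card (children T r v) = 2) \<and>
        (children T r v = {} \<longrightarrow> (\<forall>p. pre_digraph.apath (with_proj T) r p v \<longrightarrow> length p = c)))"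

text \<open>
  \<^const>\<open>subdivision\<close> keeps the vertices of the subdivided graph, and \<^const>\<open>subgraph\<close> is actual
  inclusion. So \<open>B\<close> lives on vertices of \<open>G\<close> and no isomorphism is needed.
\<close>

definition contains_subdivision_of_complete_binary_tree :: "'a pair_pre_digraph \<Rightarrow> nat \<Rightarrow> bool" where
  "contains_subdivision_of_complete_binary_tree G c \<longleftrightarrow>
     (\<exists>B S. complete_binary_tree c B \<and> subdivision_pair B S \<and>
        subgraph (with_proj S) (with_proj G))"

end

theory Submission
  imports Defs
begin

text \<open>
  Let \<open>T\<close> be a tree of height \<open>h\<close> that contains the complete ternary tree of height \<open>h\<close>. Replace
  every node by a clique on \<open>t\<close> vertices, indexed by \<open>i < t\<close>, and join the \<open>i\<close>-th vertex of a clique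
  to the vertices with index at least \<open>i\<close> of the parent clique. Adding the vertices one by one from
  the root downwards, the earlier neighbours of a new vertex form a \<open>t\<close>-clique (fewer in the root
  clique), so this graph is a \<open>t\<close>-tree and has treewidth \<open>t\<close>.

  For fixed \<open>i\<close>, the \<open>i\<close>-th vertices of the cliques form a column, a copy of \<open>T\<close>. In every path
  decomposition, some bag contains at least \<open>k + 1\<close> vertices of each column of the blow-up of a ternary
  subtree of height \<open>k\<close>: a clique lies in one bag, and of the three bags obtained for the subtrees
  below the root, the middle one is also met in each column by the connected union of the root and
  the two outer subtrees. For \<open>k = h\<close> this bag has at least \<open>t(h + 1)\<close> vertices.

  A complete binary tree of height \<open>c\<close> has at least \<open>2\<^sup>c\<close> vertices, and with
  \<open>m = max (h + 1) \<lceil>log\<^sub>2 t\<rceil>\<close> one has \<open>2\<^bsup>3m\<^esup> \<ge> 4\<^bsup>h+1\<^esup> t\<close>, which exceeds the number \<open>4\<^sup>h t\<close> of vertices of the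
  graph. So already the branch vertices of a subdivision do not fit.
\<close>

section \<open>Trees and their subtrees\<close>

text \<open>Reachability is moved to the ordinary closure of a restricted relation, where symmetry
  and induction are at hand and the walk visibly stays inside \<open>A\<close>.\<close>

lemma rtrancl_on_iff_Restr:
  "(u, v) \<in> rtrancl_on A E \<longleftrightarrow> u \<in> A \<and> (u, v) \<in> (Restr E A)\<^sup>*"
proof
  assume "(u, v) \<in> rtrancl_on A E"
  then show "u \<in> A \<and> (u, v) \<in> (Restr E A)\<^sup>*"
    by (induction rule: rtrancl_on_induct) (auto intro: rtrancl_into_rtrancl)
next
  assume "u \<in> A \<and> (u, v) \<in> (Restr E A)\<^sup>*"
  then have "(u, v) \<in> (Restr E A)\<^sup>*" "u \<in> A" by auto
  then show "(u, v) \<in> rtrancl_on A E"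
    by induction (auto intro: rtrancl_on_into_rtrancl_on)
qed

lemma connected_with_proj_iff:
  assumes "sym (parcs T)"
  shows "Digraph_Component.connected (with_proj T) \<longleftrightarrow>
    pverts T \<noteq> {} \<and> (\<forall>u\<in>pverts T. \<forall>v\<in>pverts T. (u, v) \<in> (Restr (parcs T) (pverts T))\<^sup>*)"
proof -
  have "parcs (mk_symmetric (with_proj T)) = parcs T"
    using assms by (force simp: parcs_mk_symmetric sym_def)
  then show ?thesis
    by (simp add: connected_def strongly_connected_def reachable_def rtrancl_on_iff_Restr)
qed

lemma connected_induce_subgraph_iff:
  assumes "sym (parcs T)"
  shows "Digraph_Component.connected (with_proj T \<restriction> A) \<longleftrightarrow>
    A \<noteq> {} \<and> (\<forall>u\<in>A. \<forall>v\<in>A. (u, v) \<in> (Restr (parcs T) A)\<^sup>*)"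
proof -
  have "parcs (mk_symmetric (with_proj T \<restriction> A)) = Restr (parcs T) A"
    using assms by (force simp: parcs_mk_symmetric sym_def)
  moreover have "Restr (Restr (parcs T) A) A = Restr (parcs T) A" by auto
  ultimately show ?thesis
    by (simp add: connected_def strongly_connected_def reachable_def rtrancl_on_iff_Restr)
qed

context pair_graph
begin

lemma sym_parcs: "sym (parcs G)"
  by (auto simp: sym_def intro: arcs_symmetric)

lemma awalk_to_apath_within:
  assumes "awalk u p v" "set (awalk_verts u p) \<subseteq> A"
  obtains q where "apath u q v" "set (awalk_verts u q) \<subseteq> A"
proof
  show q: "apath u (awalk_to_apath p) v"
    using assms(1) by (rule apath_awalk_to_apath)
  have "set (awalk_verts u (awalk_to_apath p)) \<subseteq> set (awalk_verts u p)"
    using awalk_to_apath_subset[OF assms(1)] set_awalk_verts[OF assms(1)]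
      set_awalk_verts[OF awalkI_apath[OF q]] by auto
  with assms(2) show "set (awalk_verts u (awalk_to_apath p)) \<subseteq> A" by blast
qed

lemma apath_within_if_rtrancl:
  assumes "(u, v) \<in> (Restr (parcs G) A)\<^sup>*" "u \<in> A" "A \<subseteq> pverts G"
  obtains p where "apath u p v" "set (awalk_verts u p) \<subseteq> A"
proof -
  from assms(1) have "\<exists>p. awalk u p v \<and> set (awalk_verts u p) \<subseteq> A"
  proof induction
    case base
    show ?case using assms(2,3) by (intro exI[of _ "[]"]) (auto simp: awalk_Nil_iff)
  next
    case (step y z)
    then obtain p where p: "awalk u p y" "set (awalk_verts u p) \<subseteq> A" by blast
    have yz: "awalk y [(y, z)] z" using step.hyps by (auto simp: awalk_simps dest: in_arcsD2)
    have "awalk u (p @ [(y, z)]) z" by (rule awalk_appendI[OF p(1) yz])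
    moreover have "set (awalk_verts u (p @ [(y, z)])) \<subseteq> A"
      using p step.hyps by (subst set_awalk_verts_append[OF p(1) yz]) auto
    ultimately show ?case by blast
  qed
  then show thesis using awalk_to_apath_within that by metis
qed

end

locale undirected_tree_locale = pair_graph T for T :: "'a pair_pre_digraph" +
  assumes tree_connected: "Digraph_Component.connected (with_proj T)"
    and tree_acyclic: "cycle p \<Longrightarrow> length p < 3"

lemma undirected_tree_iff_locale: "undirected_tree T \<longleftrightarrow> undirected_tree_locale T"
  unfolding undirected_tree_def undirected_tree_locale_def undirected_tree_locale_axioms_def
  by (auto simp: not_le)

context undirected_tree_locale
begin

text \<open>Going back from \<open>v\<close> to \<open>r\<close> and on to \<open>v'\<close> avoids
  \<open>w\<close>. If \<open>v\<close> and \<open>v'\<close> differed, a simple path extracted from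
  this walk would close through \<open>w\<close> to a forbidden cycle.\<close>

lemma last_arc_unique:
  assumes p: "apath r (p @ [(v, w)]) w" and q: "apath r (q @ [(v', w)]) w"
  shows "v = v'"
proof (rule ccontr)
  assume ne: "v \<noteq> v'"
  have pv: "awalk r p v" "w \<notin> set (awalk_verts r p)" "(v, w) \<in> parcs T"
    using p by (auto simp: apath_append_iff apath_simps dest: awalkI_apath)
  have qv: "awalk r q v'" "w \<notin> set (awalk_verts r q)" "(v', w) \<in> parcs T"
    using q by (auto simp: apath_append_iff apath_simps dest: awalkI_apath)
  have rp: "awalk v (rev_path p) r" using pv(1) by simp
  have "awalk v (rev_path p @ q) v'" by (rule awalk_appendI[OF rp qv(1)])
  moreover have "set (awalk_verts v (rev_path p @ q)) \<subseteq> - {w}"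
    using pv qv by (subst set_awalk_verts_append[OF rp qv(1)]) (simp add: awalk_verts_rev_path)
  ultimately obtain s where s: "apath v s v'" "set (awalk_verts v s) \<subseteq> - {w}"
    using awalk_to_apath_within by metis
  have sw: "awalk v s v'" using s(1) by (rule awalkI_apath)
  have v'w: "awalk v' [(v', w)] w" using qv(3) by (auto simp: awalk_simps dest: in_arcsD2)
  have c: "awalk v (s @ [(v', w)]) w" by (rule awalk_appendI[OF sw v'w])
  have "awalk w ((w, v) # s @ [(v', w)]) w"
    using c pv(3) arcs_symmetric by (auto simp: awalk_Cons_iff simp del: awalk_append_iff)
  moreover have "distinct (tl (awalk_verts w ((w, v) # s @ [(v', w)])))"
    using s sw by (auto simp: awalk_verts_append[OF c] apath_def)
  ultimately have "cycle ((w, v) # s @ [(v', w)])" unfolding cycle_def by blast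
  \<comment> \<open>The cycle has length \<open>length s + 2\<close>, so the bound leaves only the
    trivial path from \<open>v\<close> to \<open>v'\<close>.\<close>
  from tree_acyclic[OF this] have "s = []" by simp
  with s(1) ne show False by (simp add: apath_Nil_iff)
qed

lemma apath_unique:
  assumes "apath r p w" "apath r q w"
  shows "p = q"
  using assms
proof (induction p arbitrary: w q rule: rev_induct)
  case Nil
  then have "r = w" by (simp add: apath_Nil_iff)
  with Nil.prems(2) show ?case using apath_nonempty_ends by blast
next
  case (snoc e p)
  obtain v x where e: "e = (v, x)" by force
  have x: "x = w" using snoc.prems(1) e by (auto simp: apath_append_iff apath_simps)
  have "r \<noteq> w" using snoc.prems(1) by (rule apath_nonempty_ends) simp
  then have "q \<noteq> []" using snoc.prems(2) by (auto simp: apath_Nil_iff)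
  then obtain q' v' x' where q: "q = q' @ [(v', x')]" by (metis rev_exhaust surj_pair)
  have x': "x' = w" using snoc.prems(2) q by (auto simp: apath_append_iff apath_simps)
  have "v = v'" using snoc.prems unfolding e x q x' by (rule last_arc_unique)
  moreover have "apath r p v" using snoc.prems(1) e by (auto simp: apath_append_iff apath_simps)
  moreover have "apath r q' v'" using snoc.prems(2) q by (auto simp: apath_append_iff apath_simps)
  ultimately show ?case using snoc.IH e x q x' by auto
qed

lemma apath_exists:
  assumes "u \<in> pverts T" "v \<in> pverts T"
  obtains p where "apath u p v"
proof -
  have "(u, v) \<in> (Restr (parcs T) (pverts T))\<^sup>*"
    using tree_connected assms by (simp add: connected_with_proj_iff[OF sym_parcs])
  then show thesis using assms(1) that apath_within_if_rtrancl by blast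
qed

text \<open>
  A connected set \<open>S\<close> is entered from \<open>r\<close> at its vertex closest to \<open>r\<close>, on the way to each of its
  vertices.
\<close>

lemma subtree_entry:
  assumes S: "S \<subseteq> pverts T" "Digraph_Component.connected (with_proj T \<restriction> S)" and r: "r \<in> pverts T"
  obtains z p where "z \<in> S" "apath r p z"
    "\<And>y py. y \<in> S \<Longrightarrow> apath r py y \<Longrightarrow> \<exists>q. py = p @ q \<and> set (awalk_verts z q) \<subseteq> S"
proof -
  have conn: "S \<noteq> {}" "\<And>u v. u \<in> S \<Longrightarrow> v \<in> S \<Longrightarrow> (u, v) \<in> (Restr (parcs T) S)\<^sup>*"
    using S(2) by (auto simp: connected_induce_subgraph_iff[OF sym_parcs])
  then obtain s where "s \<in> S" by blast
  then obtain ps where "apath r ps s" using S(1) r apath_exists by blast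
  with \<open>s \<in> S\<close> have "\<exists>z\<in>S. apath r ps z" by blast
  then obtain p where p: "\<exists>z\<in>S. apath r p z"
    and min: "\<And>p'. \<exists>z\<in>S. apath r p' z \<Longrightarrow> length p \<le> length p'"
    using ex_has_least_nat[of "\<lambda>p. \<exists>z\<in>S. apath r p z" _ length] by blast
  from p obtain z where z: "z \<in> S" "apath r p z" by blast
  have "\<exists>q. py = p @ q \<and> set (awalk_verts z q) \<subseteq> S" if y: "y \<in> S" "apath r py y" for y py
  proof -
    obtain q where q: "apath z q y" "set (awalk_verts z q) \<subseteq> S"
      using apath_within_if_rtrancl[OF conn(2)[OF z(1) y(1)] z(1) S(1)] by blast
    have pz: "awlast r p = z" using z(2) by (auto dest: awalkI_apath)
    \<comment> \<open>A common vertex \<open>x\<close> lies in \<open>S\<close> and ends a prefix of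
      \<open>p\<close>. As \<open>p\<close> is a shortest path from \<open>r\<close> into
      \<open>S\<close>, this forces \<open>x = z\<close>, but \<open>z\<close> is the start of the
      simple path \<open>q\<close> and does not recur.\<close>
    have "set (awalk_verts r p) \<inter> set (tl (awalk_verts z q)) = {}"
    proof (rule ccontr)
      assume "\<not> ?thesis"
      then obtain x where x: "x \<in> set (awalk_verts r p)" "x \<in> set (tl (awalk_verts z q))" by blast
      from x(2) have "x \<in> S" using q(2) by (meson list.set_sel(2) awalk_verts_non_Nil subsetD)
      obtain p1 p2 where d: "p = p1 @ p2" "awalk r p1 x" "awalk x p2 z"
        using awalk_decomp[OF awalkI_apath[OF z(2)] x(1)] by blast
      then have "apath r p1 x" using z(2) by (auto simp: apath_append_iff)
      then have "length p \<le> length p1" using min \<open>x \<in> S\<close> by blast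
      then have "x = z" using d by (auto simp: awalk_Nil_iff)
      moreover have "z = hd (awalk_verts z q)" using q(1) by (auto dest: awalkI_apath)
      moreover have "distinct (awalk_verts z q)" using q(1) by (simp add: apath_def)
      ultimately show False using x(2)
        by (metis awalk_verts_non_Nil distinct.simps(2) list.collapse)
    qed
    then have "apath r (p @ q) y" using z(2) q(1) pz by (simp add: apath_append_iff)
    then have "py = p @ q" using y(2) apath_unique by blast
    with q(2) show ?thesis by blast
  qed
  with z that show thesis by blast
qed

text \<open>Root the tree at \<open>r\<close>; the deepest entry vertex \<open>z i\<close> is common
  to all sets. For a given \<open>j\<close>, take \<open>y\<close> in both \<open>S i\<close> and
  \<open>S j\<close>: the path from \<open>r\<close> to \<open>y\<close> passes \<open>z j\<close>
  no later than \<open>z i\<close>, and from \<open>z j\<close> on it stays in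
  \<open>S j\<close>.\<close>

lemma subtree_Helly:
  fixes S :: "'i \<Rightarrow> 'a set"
  assumes I: "finite I" "I \<noteq> {}"
    and sub: "\<And>i. i \<in> I \<Longrightarrow> S i \<subseteq> pverts T"
    and conn: "\<And>i. i \<in> I \<Longrightarrow> Digraph_Component.connected (with_proj T \<restriction> S i)"
    and int: "\<And>i j. i \<in> I \<Longrightarrow> j \<in> I \<Longrightarrow> S i \<inter> S j \<noteq> {}"
  obtains x where "x \<in> pverts T" "\<And>i. i \<in> I \<Longrightarrow> x \<in> S i"
proof -
  obtain r where r: "r \<in> pverts T" using I(2) sub int by blast
  have "\<forall>i\<in>I. \<exists>z p. z \<in> S i \<and> apath r p z \<and>
      (\<forall>y py. y \<in> S i \<longrightarrow> apath r py y \<longrightarrow> (\<exists>q. py = p @ q \<and> set (awalk_verts z q) \<subseteq> S i))"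
    using subtree_entry[OF sub conn r] by (metis (no_types, lifting))
  then obtain z p where z: "\<And>i. i \<in> I \<Longrightarrow> z i \<in> S i" "\<And>i. i \<in> I \<Longrightarrow> apath r (p i) (z i)"
    and zp: "\<And>i y py. i \<in> I \<Longrightarrow> y \<in> S i \<Longrightarrow> apath r py y \<Longrightarrow>
      \<exists>q. py = p i @ q \<and> set (awalk_verts (z i) q) \<subseteq> S i"
    by metis
  have "Max ((length \<circ> p) ` I) \<in> (length \<circ> p) ` I" using I by (intro Max_in) auto
  then obtain i where i: "i \<in> I" "length (p i) = Max ((length \<circ> p) ` I)" by auto
  have max: "length (p j) \<le> length (p i)" if "j \<in> I" for j
    using that I(1) unfolding i(2) by (intro Max_ge) auto
  have "z i \<in> S j" if j: "j \<in> I" for j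
  proof -
    obtain y where y: "y \<in> S i" "y \<in> S j" using int i(1) j by blast
    obtain py where py: "apath r py y" using apath_exists[OF r] y(1) sub i(1) by blast
    obtain q where q: "py = p i @ q" using zp[OF i(1) y(1) py] by blast
    obtain q' where q': "py = p j @ q'" "set (awalk_verts (z j) q') \<subseteq> S j"
      using zp[OF j y(2) py] by blast
    have "p j @ q' = p i @ q" using q q'(1) by simp
    then obtain s where s: "p i = p j @ s" "q' = s @ q"
      using max[OF j] that by (fastforce simp: append_eq_append_conv2)
    have "awlast r (p j) = z j" using z(2)[OF j] by (auto dest: awalkI_apath)
    then have zs: "awalk (z j) s (z i)"
      using awalkI_apath[OF z(2)[OF i(1)]] by (simp add: s(1))
    have "apath (z j) q' y" using py q'(1) \<open>awlast r (p j) = z j\<close> by (simp add: apath_append_iff)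
    then have "awalk (z j) (s @ q) y" unfolding s(2) by (rule awalkI_apath)
    then have "set (awalk_verts (z j) s) \<subseteq> set (awalk_verts (z j) q')"
      unfolding s(2) by (simp add: awalk_verts_append del: awalk_append_iff)
    moreover have "z i \<in> set (awalk_verts (z j) s)"
      using zs by (metis awalk_verts_non_Nil awlast_of_awalk last_in_set awalkE')
    ultimately show ?thesis using q'(2) by blast
  qed
  with that z(1)[OF i(1)] sub[OF i(1)] show thesis by blast
qed

end

section \<open>Complete binary trees\<close>

text \<open>Level \<open>k\<close> has at least \<open>2 ^ k\<close> vertices for
  \<open>k \<le> c\<close>: a vertex of depth less than \<open>c\<close> is no leaf and so has two
  children, and distinct vertices share no child by \<open>last_arc_unique\<close>.\<close>

lemma (in undirected_tree_locale) card_pverts_ge_if_binary: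
  assumes r: "r \<in> pverts T"
    and two: "\<And>v. v \<in> pverts T \<Longrightarrow> children T r v \<noteq> {} \<Longrightarrow> card (children T r v) = 2"
    and leaf: "\<And>v p. v \<in> pverts T \<Longrightarrow> children T r v = {} \<Longrightarrow> apath r p v \<Longrightarrow> length p = c"
  shows "2 ^ c \<le> card (pverts T)"
proof -
  define L where "L k = {v. \<exists>p. apath r p v \<and> length p = k}" for k
  have L_sub: "L k \<subseteq> pverts T" for k
    by (auto simp: L_def dest: awalkI_apath awalk_last_in_verts)
  have fin_L: "finite (L k)" for k using L_sub pair_finite_verts by (rule finite_subset)
  have children: "children T r v \<subseteq> L (Suc k)" if "v \<in> L k" for v k
  proof
    fix w assume "w \<in> children T r v"
    then obtain p where p: "apath r (p @ [(v, w)]) w" by (auto simp: children_def)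
    then have "apath r p v" by (auto simp: apath_append_iff apath_simps)
    with that have "length p = k" using apath_unique by (auto simp: L_def)
    then show "w \<in> L (Suc k)" using p by (force simp: L_def)
  qed
  have "2 ^ k \<le> card (L k)" if "k \<le> c" for k
    using that
  proof (induction k)
    case 0
    have "r \<in> L 0" using r by (auto simp: L_def apath_Nil_iff)
    then have "card (L 0) \<noteq> 0" using fin_L by auto
    then show ?case by simp
  next
    case (Suc k)
    have two': "card (children T r v) = 2" if v: "v \<in> L k" for v
    proof (rule two)
      show "v \<in> pverts T" using v L_sub by blast
      then show "children T r v \<noteq> {}" using leaf v Suc.prems by (fastforce simp: L_def)
    qed
    have "2 ^ Suc k \<le> (\<Sum>v\<in>L k. card (children T r v))"
      using Suc two' by simp
    also have "\<dots> = card (\<Union>v\<in>L k. children T r v)"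
    proof (rule card_UN_disjoint[symmetric])
      show "\<forall>v\<in>L k. finite (children T r v)"
        using children fin_L finite_subset by blast
      show "\<forall>v\<in>L k. \<forall>w\<in>L k. v \<noteq> w \<longrightarrow> children T r v \<inter> children T r w = {}"
        using last_arc_unique by (fastforce simp: children_def)
    qed (rule fin_L)
    also have "\<dots> \<le> card (L (Suc k))"
      using children by (intro card_mono fin_L) blast
    finally show ?case .
  qed
  then have "2 ^ c \<le> card (L c)" by simp
  also have "\<dots> \<le> card (pverts T)" using L_sub pair_finite_verts by (intro card_mono)
  finally show ?thesis .
qed

lemma complete_binary_tree_card:
  assumes "complete_binary_tree c T"
  shows "2 ^ c \<le> card (pverts T)"
proof -
  interpret undirected_tree_locale T
    using assms by (simp add: complete_binary_tree_def undirected_tree_iff_locale)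
  from assms obtain r where "r \<in> pverts T"
    "\<forall>v\<in>pverts T. (children T r v \<noteq> {} \<longrightarrow> card (children T r v) = 2) \<and>
      (children T r v = {} \<longrightarrow> (\<forall>p. apath r p v \<longrightarrow> length p = c))"
    by (auto simp: complete_binary_tree_def)
  then show ?thesis by (intro card_pverts_ge_if_binary[of r]) auto
qed

lemma subdivision_verts_mono: "subdivision_pair G H \<Longrightarrow> pverts G \<subseteq> pverts H"
  by (induction rule: subdivision_pair_induct) auto

lemma card_ge_if_contains_subdivision:
  assumes "contains_subdivision_of_complete_binary_tree G c" "finite (pverts G)"
  shows "2 ^ c \<le> card (pverts G)"
proof -
  obtain T S where T: "complete_binary_tree c T" "subdivision_pair T S"
    and S: "subgraph (with_proj S) (with_proj G)"
    using assms(1) by (auto simp: contains_subdivision_of_complete_binary_tree_def)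
  have "pverts T \<subseteq> pverts G"
    using subdivision_verts_mono[OF T(2)] subgraph_imp_subverts[OF S] by simp
  then have "card (pverts T) \<le> card (pverts G)" using assms(2) by (rule card_mono[rotated])
  with complete_binary_tree_card[OF T(1)] show ?thesis by simp
qed


section \<open>Tree and path decompositions\<close>

text \<open>Helly property of the node sets \<open>S v\<close> for \<open>v\<close> in the clique:
  each is connected, and two of them meet because adjacent vertices share a bag.\<close>

lemma tree_decomposition_clique_bag:
  assumes td: "tree_decomposition G T B"
    and K: "finite K" "K \<noteq> {}" "K \<subseteq> pverts G"
    and clique: "\<And>u v. u \<in> K \<Longrightarrow> v \<in> K \<Longrightarrow> u \<noteq> v \<Longrightarrow> (u, v) \<in> parcs G"
  obtains x where "x \<in> pverts T" "K \<subseteq> B x"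
proof -
  interpret undirected_tree_locale T
    using td by (simp add: tree_decomposition_def undirected_tree_iff_locale)
  define S where "S v = {x \<in> pverts T. v \<in> B x}" for v
  have conn: "Digraph_Component.connected (with_proj T \<restriction> S v)" if "v \<in> K" for v
    using td K(3) that by (auto simp: tree_decomposition_def S_def)
  have meet: "S u \<inter> S v \<noteq> {}" if uv: "u \<in> K" "v \<in> K" for u v
  proof (cases "u = v")
    case True
    then show ?thesis
      using conn[OF uv(1)] by (simp add: connected_induce_subgraph_iff[OF sym_parcs])
  next
    case False
    then show ?thesis
      using td clique[OF uv] by (fastforce simp: tree_decomposition_def S_def)
  qed
  obtain x where "x \<in> pverts T" "\<And>v. v \<in> K \<Longrightarrow> x \<in> S v"
    using subtree_Helly[of K S, OF K(1,2) _ conn meet] by (auto simp: S_def)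
  with that show thesis by (auto simp: S_def)
qed

lemma card_bag_le_width:
  assumes "tree_decomposition G T B" "x \<in> pverts T"
  shows "card (B x) \<le> decomposition_width T B + 1"
proof -
  interpret undirected_tree_locale T
    using assms by (simp add: tree_decomposition_def undirected_tree_iff_locale)
  have "card (B x) \<le> Max ((\<lambda>x. card (B x)) ` pverts T)"
    using assms(2) pair_finite_verts by (intro Max_ge) auto
  then show ?thesis by (simp add: decomposition_width_def)
qed

lemma vwalk_arcs_nth:
  "(a, b) \<in> set (vwalk_arcs xs) \<longleftrightarrow> (\<exists>i. Suc i < length xs \<and> a = xs ! i \<and> b = xs ! Suc i)"
proof (induction xs rule: vwalk_arcs.induct)
  case (3 x y xs)
  have "(\<exists>i. Suc i < length (x # y # xs) \<and> a = (x # y # xs) ! i \<and> b = (x # y # xs) ! Suc i) \<longleftrightarrow>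
    a = x \<and> b = y \<or> (\<exists>i. Suc i < length (y # xs) \<and> a = (y # xs) ! i \<and> b = (y # xs) ! Suc i)"
    (is "?L \<longleftrightarrow> ?R")
  proof
    assume ?L
    then obtain i where "Suc i < length (x # y # xs) \<and> a = (x # y # xs) ! i \<and> b = (x # y # xs) ! Suc i" ..
    then show ?R by (cases i) auto
  next
    assume ?R
    then show ?L by (elim disjE exE) (auto intro: exI[of _ 0] exI[of _ "Suc _"])
  qed
  then show ?case using 3 by simp
qed auto

text \<open>A walk along the path changes the index by one in each step, so it cannot get from below
  \<open>k\<close> to above \<open>k\<close> without visiting index \<open>k\<close>.\<close>

lemma connected_path_convex:
  assumes xs: "distinct xs" "E = set (vwalk_arcs xs) \<union> (set (vwalk_arcs xs))\<inverse>"
    and conn: "(xs ! i, xs ! j) \<in> (Restr E A)\<^sup>*"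
    and ij: "xs ! i \<in> A" "i \<le> k" "k \<le> j" "j < length xs"
  shows "xs ! k \<in> A"
proof (rule ccontr)
  assume k: "xs ! k \<notin> A"
  from conn have "\<exists>m<k. xs ! j = xs ! m"
  proof induction
    case base
    then show ?case using ij k by (metis le_neq_implies_less)
  next
    case (step y z)
    then obtain m where m: "m < k" "y = xs ! m" by blast
    from step.hyps xs(2) obtain l where l: "Suc l < length xs"
      "y = xs ! l \<and> z = xs ! Suc l \<or> z = xs ! l \<and> y = xs ! Suc l"
      by (auto simp: vwalk_arcs_nth)
    from l(2) show ?case
    proof
      assume yz: "y = xs ! l \<and> z = xs ! Suc l"
      then have "l = m" using m l(1) ij xs(1) by (simp add: nth_eq_iff_index_eq)
      moreover have "Suc l \<noteq> k" using yz step.hyps k by auto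
      ultimately show ?thesis using yz m(1) by (metis Suc_lessI)
    next
      assume yz: "z = xs ! l \<and> y = xs ! Suc l"
      then have "Suc l = m" using m l(1) ij xs(1) by (simp add: nth_eq_iff_index_eq)
      then show ?thesis using yz m(1) by (metis Suc_lessD)
    qed
  qed
  then show False using xs(1) ij by (auto simp: nth_eq_iff_index_eq)
qed

text \<open>If the bag at \<open>k\<close> missed \<open>C\<close>, then by convexity each vertex of
  \<open>C\<close> would have all its bags on one side of \<open>k\<close>. Adjacent vertices share
  a bag, so a walk inside \<open>C\<close> could never change sides.\<close>

lemma path_decomposition_sequence:
  assumes pd: "path_decomposition G P B"
  obtains xs where "pverts P = set xs"
    "\<And>C u v i k j. (u, v) \<in> (Restr (parcs G) C)\<^sup>* \<Longrightarrow> C \<subseteq> pverts G \<Longrightarrow> u \<in> C \<inter> B (xs ! i) \<Longrightarrow>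
      v \<in> C \<inter> B (xs ! j) \<Longrightarrow> i \<le> k \<Longrightarrow> k \<le> j \<Longrightarrow> j < length xs \<Longrightarrow> C \<inter> B (xs ! k) \<noteq> {}"
proof -
  have td: "tree_decomposition G P B" and path: "path_graph P"
    using pd by (auto simp: path_decomposition_def)
  interpret undirected_tree_locale P
    using td by (simp add: tree_decomposition_def undirected_tree_iff_locale)
  obtain xs where xs: "distinct xs" "pverts P = set xs"
    "parcs P = set (vwalk_arcs xs) \<union> (set (vwalk_arcs xs))\<inverse>"
    using path by (auto simp: path_graph_def)
  have convex: "w \<in> B (xs ! k)"
    if w: "w \<in> pverts G" "w \<in> B (xs ! i)" "w \<in> B (xs ! j)" and ij: "i \<le> k" "k \<le> j" "j < length xs"
    for w i j k
  proof -
    let ?A = "{x \<in> pverts P. w \<in> B x}"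
    have "Digraph_Component.connected (with_proj P \<restriction> ?A)"
      using td w(1) by (auto simp: tree_decomposition_def)
    moreover have A: "xs ! i \<in> ?A" "xs ! j \<in> ?A" using w ij by (auto simp: xs(2))
    ultimately have "(xs ! i, xs ! j) \<in> (Restr (parcs P) ?A)\<^sup>*"
      by (auto simp: connected_induce_subgraph_iff[OF sym_parcs])
    from connected_path_convex[OF xs(1,3) this A(1) ij] show ?thesis by simp
  qed
  have "C \<inter> B (xs ! k) \<noteq> {}"
    if C: "(u, v) \<in> (Restr (parcs G) C)\<^sup>*" "C \<subseteq> pverts G" and u: "u \<in> C \<inter> B (xs ! i)"
      and v: "v \<in> C \<inter> B (xs ! j)" and ij: "i \<le> k" "k \<le> j" "j < length xs" for C u v i j k
  proof
    assume empty: "C \<inter> B (xs ! k) = {}"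
    \<comment> \<open>Invariant along the walk: the current vertex occurs in a bag before
      \<open>k\<close>.\<close>
    from C(1) have "\<exists>m<k. v \<in> B (xs ! m)"
    proof induction
      case base
      then show ?case using u empty ij(1) by (metis IntD1 IntD2 IntI empty_iff le_neq_implies_less)
    next
      case (step y z)
      then obtain m where m: "m < k" "y \<in> B (xs ! m)" by blast
      have yz: "y \<in> C" "(y, z) \<in> parcs G" using step.hyps by auto
      then obtain l where l: "l < length xs" "y \<in> B (xs ! l)" "z \<in> B (xs ! l)"
        using td xs(2) by (fastforce simp: tree_decomposition_def in_set_conv_nth)
      have "l < k"
      proof (rule ccontr)
        assume "\<not> l < k"
        then have "y \<in> B (xs ! k)" using convex[of y m l k] m l yz(1) C(2) by auto
        then show False using empty yz(1) by blast
      qed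
      then show ?case using l(3) by blast
    qed
    then have "v \<in> B (xs ! k)" using convex[of v _ j k] v C(2) ij by (meson IntD1 IntD2 less_imp_le subsetD)
    then show False using empty v by blast
  qed
  with that xs(2) show thesis by blast
qed

section \<open>Decompositions from parent functions and bounds on the widths\<close>

text \<open>Meant for \<open>f x < x\<close> when \<open>0 < x\<close>: numbering parents before
  children makes climbing to the root an induction over the natural numbers. The guards exempt the
  root 0 from having a parent.\<close>

definition parent_tree :: "nat \<Rightarrow> (nat \<Rightarrow> nat) \<Rightarrow> nat pair_pre_digraph" where
  "parent_tree n f = \<lparr>pverts = {..<n},
     parcs = {(x, y). x < n \<and> y < n \<and> (0 < x \<and> y = f x \<or> 0 < y \<and> x = f y)}\<rparr>"

lemma parent_tree_simps [simp]:
  "pverts (parent_tree n f) = {..<n}"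
  "(x, y) \<in> parcs (parent_tree n f) \<longleftrightarrow> x < n \<and> y < n \<and> (0 < x \<and> y = f x \<or> 0 < y \<and> x = f y)"
  by (auto simp: parent_tree_def)

lemma pair_graphI:
  assumes "finite (pverts G)" "sym (parcs G)"
    "\<And>u v. (u, v) \<in> parcs G \<Longrightarrow> u \<in> pverts G \<and> u \<noteq> v"
  shows "pair_graph G"
proof -
  have sub: "parcs G \<subseteq> pverts G \<times> pverts G"
    using assms(2,3) by (auto simp: sym_def)
  then have "finite (parcs G)" using assms(1) by (meson finite_SigmaI finite_subset)
  with assms sub show ?thesis
    by unfold_locales (auto simp: symmetric_def)
qed

text \<open>Every element descends to \<open>a\<close> along \<open>f\<close>, and symmetry reverses
  one of two descents. This gives the connectedness of parent trees, of the node sets of a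
  decomposition, and of columns of the blow-up.\<close>

lemma rtrancl_to_root:
  fixes f :: "nat \<Rightarrow> nat"
  assumes "sym E"
    and step: "\<And>x. x \<in> A \<Longrightarrow> x \<noteq> a \<Longrightarrow> (x, f x) \<in> E \<and> f x \<in> A \<and> f x < x"
    and uv: "u \<in> A" "v \<in> A"
  shows "(u, v) \<in> (Restr E A)\<^sup>*"
proof -
  have to_a: "(x, a) \<in> (Restr E A)\<^sup>*" if "x \<in> A" for x
    using that
  proof (induction x rule: less_induct)
    case (less x)
    show ?case
    proof (cases "x = a")
      case False
      with step[OF less.prems] less have "(x, f x) \<in> Restr E A" "(f x, a) \<in> (Restr E A)\<^sup>*" by auto
      then show ?thesis by (rule converse_rtrancl_into_rtrancl)
    qed simp
  qed
  have "sym ((Restr E A)\<^sup>*)" using assms(1) by (intro sym_rtrancl) (auto simp: sym_def)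
  with to_a[OF uv(1)] to_a[OF uv(2)] show ?thesis by (meson rtrancl_trans symE)
qed

text \<open>
  The largest vertex of a cycle would have its parent as both of its neighbours on the cycle.
\<close>

lemma no_cycle_decreasing:
  fixes c :: "nat \<Rightarrow> nat"
  assumes k: "3 \<le> k" and closed: "c 0 = c k" and inj: "inj_on c {1..k}"
    and adj: "\<And>i. i < k \<Longrightarrow> f (c i) = c (Suc i) \<and> c (Suc i) < c i \<or> f (c (Suc i)) = c i \<and> c i < c (Suc i)"
  shows False
proof -
  have "Max (c ` {1..k}) \<in> c ` {1..k}" using k by (intro Max_in) auto
  then obtain i where i: "i \<in> {1..k}" and "c i = Max (c ` {1..k})" by auto
  then have max: "c j \<le> c i" if "j \<in> {1..k}" for j
    using that by (metis Max_ge finite_atLeastAtMost finite_imageI imageI)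
  \<comment> \<open>\<open>p\<close> and \<open>s\<close> are the cyclic predecessor and successor
    of \<open>i\<close> in \<open>{1..k}\<close>; they differ because \<open>k\<close> is at least
    3.\<close>
  define p where "p = (if i = 1 then k else i - 1)"
  define s where "s = (if i = k then 1 else Suc i)"
  have ps: "p \<in> {1..k}" "s \<in> {1..k}" "p \<noteq> s" using i k by (auto simp: p_def s_def)
  have "c (i - 1) = c p" using closed by (auto simp: p_def)
  moreover have "i - 1 < k" "Suc (i - 1) = i" using i by auto
  ultimately have "f (c i) = c p" using adj[of "i - 1"] max[OF ps(1)] by auto
  moreover have "f (c i) = c s"
  proof (cases "i = k")
    case True
    then show ?thesis using adj[of 0] k closed max[OF ps(2)] by (auto simp: s_def)
  next
    case False
    then show ?thesis using adj[of i] i max[OF ps(2)] by (auto simp: s_def)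
  qed
  ultimately show False using inj ps by (metis inj_onD)
qed

lemma undirected_tree_parent_tree:
  assumes "0 < n" and f: "\<And>x. 0 < x \<Longrightarrow> x < n \<Longrightarrow> f x < x"
  shows "undirected_tree (parent_tree n f)"
proof -
  let ?T = "parent_tree n f"
  have sym: "sym (parcs ?T)" by (auto simp: sym_def)
  interpret pair_graph ?T
  proof (rule pair_graphI[OF _ sym])
    show "finite (pverts ?T)" by simp
    show "u \<in> pverts ?T \<and> u \<noteq> v" if "(u, v) \<in> parcs ?T" for u v
      using that f[of u] f[of v] by auto
  qed
  have "(u, v) \<in> (Restr (parcs ?T) {..<n})\<^sup>*" if "u \<in> {..<n}" "v \<in> {..<n}" for u v
    using sym _ that
  proof (rule rtrancl_to_root)
    show "(x, f x) \<in> parcs ?T \<and> f x \<in> {..<n} \<and> f x < x" if "x \<in> {..<n}" "x \<noteq> 0" for x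
      using that f[of x] by auto
  qed
  then have conn: "Digraph_Component.connected (with_proj ?T)"
    using assms(1) by (auto simp: connected_with_proj_iff[OF sym])
  have "length p < 3" if "cycle p" for p
  proof (rule ccontr)
    assume "\<not> length p < 3"
    then have k: "3 \<le> length p" by simp
    from that obtain u where u: "awalk u p u" "distinct (tl (awalk_verts u p))"
      by (auto simp: cycle_def)
    \<comment> \<open>The start of the cycle is listed twice, at indices 0 and
      \<open>length p\<close>, so injectivity is claimed from index 1 on.\<close>
    define c where "c i = awalk_verts u p ! i" for i
    have len: "length (awalk_verts u p) = Suc (length p)" by (rule length_awalk_verts)
    have ends: "c 0 = u" "c (length p) = u"
      using awhd_of_awalk[OF u(1)] awlast_of_awalk[OF u(1)] len
      by (auto simp: c_def hd_conv_nth last_conv_nth)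
    have tl: "tl (awalk_verts u p) ! (i - 1) = c i" if "i \<in> {1..length p}" for i
      using that len by (cases i) (auto simp: c_def nth_tl)
    have "inj_on c {1..length p}"
    proof (rule inj_onI)
      fix i j assume ij: "i \<in> {1..length p}" "j \<in> {1..length p}" "c i = c j"
      then have "tl (awalk_verts u p) ! (i - 1) = tl (awalk_verts u p) ! (j - 1)"
        using tl[OF ij(1)] tl[OF ij(2)] ij(3) by simp
      moreover have "i - 1 < length (tl (awalk_verts u p))" "j - 1 < length (tl (awalk_verts u p))"
        using ij len by auto
      ultimately have "i - 1 = j - 1" using u(2) by (simp add: nth_eq_iff_index_eq)
      then show "i = j" using ij by auto
    qed
    moreover have "f (c i) = c (Suc i) \<and> c (Suc i) < c i \<or> f (c (Suc i)) = c i \<and> c i < c (Suc i)"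
      if i: "i < length p" for i
    proof -
      have "awalk_verts u p = u # map snd p"
        using awalk_verts_conv'[of u p u] u(1) k awalkE' by (cases p) (auto simp: awalk_Cons_iff)
      then have "snd (p ! i) = c (Suc i)" using i by (simp add: c_def)
      moreover have "fst (p ! i) = c i"
        using i k by (auto simp: c_def awalk_verts_conv nth_append)
      moreover have "p ! i \<in> parcs ?T" using u(1) i by (auto simp: awalk_def)
      ultimately have "(c i, c (Suc i)) \<in> parcs ?T" by (metis prod.collapse)
      then show ?thesis using f[of "c i"] f[of "c (Suc i)"] by auto
    qed
    ultimately show False using no_cycle_decreasing[OF k] ends by metis
  qed
  with conn show ?thesis
    unfolding undirected_tree_def by (auto simp: not_less[symmetric] intro: pair_graph_axioms)
qed

text \<open>The graph is given by an insertion order: \<open>N v\<close> is intended as the set of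
  neighbours of \<open>v\<close> that precede it.\<close>

definition back_graph :: "nat \<Rightarrow> (nat \<Rightarrow> nat set) \<Rightarrow> nat pair_pre_digraph" where
  "back_graph n N = \<lparr>pverts = {..<n},
     parcs = {(v, w). v < n \<and> w < n \<and> (v \<in> N w \<or> w \<in> N v)}\<rparr>"

lemma back_graph_simps [simp]:
  "pverts (back_graph n N) = {..<n}"
  "(v, w) \<in> parcs (back_graph n N) \<longleftrightarrow> v < n \<and> w < n \<and> (v \<in> N w \<or> w \<in> N v)"
  by (auto simp: back_graph_def)

lemma pair_graph_back_graph:
  assumes "\<And>v. N v \<subseteq> {..<v}"
  shows "pair_graph (back_graph n N)"
proof (rule pair_graphI)
  show "sym (parcs (back_graph n N))" by (auto simp: sym_def)
  show "u \<in> pverts (back_graph n N) \<and> u \<noteq> v" if "(u, v) \<in> parcs (back_graph n N)" for u v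
    using that assms[of u] by auto
qed simp

lemma treewidth_le:
  assumes "tree_decomposition G (T :: nat pair_pre_digraph) B"
    and "\<And>x. x \<in> pverts T \<Longrightarrow> card (B x) \<le> Suc k"
  shows "treewidth G \<le> k"
proof -
  interpret undirected_tree_locale T
    using assms by (simp add: tree_decomposition_def undirected_tree_iff_locale)
  have "pverts T \<noteq> {}"
    using tree_connected by (simp add: connected_with_proj_iff[OF sym_parcs])
  then have "decomposition_width T B \<le> k"
    using pair_finite_verts assms(2) by (auto simp: decomposition_width_def le_diff_conv)
  moreover have "treewidth G \<le> decomposition_width T B"
    unfolding treewidth_def using assms(1) by (intro cInf_lower) auto
  ultimately show ?thesis by simp
qed

lemma treewidth_ge:
  assumes "tree_decomposition G (T :: nat pair_pre_digraph) B"
    and "\<And>(T :: nat pair_pre_digraph) B. tree_decomposition G T B \<Longrightarrow> \<exists>x\<in>pverts T. k < card (B x)"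
  shows "k \<le> treewidth G"
  unfolding treewidth_def
proof (rule cInf_greatest)
  show "{decomposition_width T B |(T :: nat pair_pre_digraph) B. tree_decomposition G T B} \<noteq> {}"
    using assms(1) by blast
  fix w assume "w \<in> {decomposition_width T B |(T :: nat pair_pre_digraph) B. tree_decomposition G T B}"
  then obtain T :: "nat pair_pre_digraph" and B
    where T: "w = decomposition_width T B" "tree_decomposition G T B" by blast
  then obtain x where "x \<in> pverts T" "k < card (B x)" using assms(2) by blast
  then show "k \<le> w" using card_bag_le_width[OF T(2)] T(1) by fastforce
qed

text \<open>Guarantees that the infimum defining \<open>pathwidth\<close> ranges over a nonempty
  set.\<close>

lemma single_bag_decomposition:
  assumes "pair_graph G"
  shows "path_decomposition G (parent_tree 1 f) (\<lambda>_. pverts G)"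
proof -
  interpret pair_graph G by fact
  have sym: "sym (parcs (parent_tree 1 f))" by (auto simp: sym_def)
  have "path_graph (parent_tree 1 f)"
    unfolding path_graph_def by (intro exI[of _ "[0]"]) (auto simp: parent_tree_def)
  moreover have "undirected_tree (parent_tree 1 f)" by (rule undirected_tree_parent_tree) auto
  ultimately show ?thesis
    by (auto simp: path_decomposition_def tree_decomposition_def wellformed'
        connected_induce_subgraph_iff[OF sym] simp del: One_nat_def)
qed

lemma pathwidth_ge:
  assumes "pair_graph G"
    and "\<And>(P :: nat pair_pre_digraph) B. path_decomposition G P B \<Longrightarrow> \<exists>x\<in>pverts P. k \<le> card (B x)"
  shows "k - 1 \<le> pathwidth G"
  unfolding pathwidth_def
proof (rule cInf_greatest)
  show "{decomposition_width P B |(P :: nat pair_pre_digraph) B. path_decomposition G P B} \<noteq> {}"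
    using single_bag_decomposition[OF assms(1)] by blast
  fix w assume "w \<in> {decomposition_width P B |(P :: nat pair_pre_digraph) B. path_decomposition G P B}"
  then obtain P :: "nat pair_pre_digraph" and B
    where P: "w = decomposition_width P B" "path_decomposition G P B" by blast
  then obtain x where "x \<in> pverts P" "k \<le> card (B x)" using assms(2) by blast
  then show "k - 1 \<le> w"
    using card_bag_le_width[of G P B x] P by (fastforce simp: path_decomposition_def)
qed

text \<open>An edge is covered by the bag of its later end. The nodes whose bags contain
  \<open>v\<close> form a subtree with top \<open>v\<close>: for any other such node
  \<open>x\<close>, the inclusion for \<open>N x\<close> puts \<open>v\<close> into the bag of
  \<open>f x\<close> as well.\<close>

lemma back_graph_tree_decomposition:
  assumes "0 < n" and N: "\<And>v. N v \<subseteq> {..<v}"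
    and f: "\<And>v. 0 < v \<Longrightarrow> f v < v \<and> N v \<subseteq> insert (f v) (N (f v))"
  shows "tree_decomposition (back_graph n N) (parent_tree n f) (\<lambda>v. insert v (N v))"
proof -
  let ?T = "parent_tree n f"
  have sym: "sym (parcs ?T)" by (auto simp: sym_def)
  have tree: "undirected_tree ?T" using assms(1) f by (intro undirected_tree_parent_tree) auto
  have "Digraph_Component.connected (with_proj ?T \<restriction> {x \<in> pverts ?T. v \<in> insert x (N x)})"
    (is "Digraph_Component.connected (_ \<restriction> ?A)") if v: "v < n" for v
  proof -
    have "(x, y) \<in> (Restr (parcs ?T) ?A)\<^sup>*" if "x \<in> ?A" "y \<in> ?A" for x y
      using sym _ that
    proof (rule rtrancl_to_root)
      fix x assume x: "x \<in> ?A" "x \<noteq> v"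
      then have "v \<in> N x" "x < n" by auto
      moreover from this have "0 < x" using N[of x] by auto
      ultimately show "(x, f x) \<in> parcs ?T \<and> f x \<in> ?A \<and> f x < x" using f[of x] by auto
    qed
    moreover have "v \<in> ?A" using v by simp
    ultimately show ?thesis by (auto simp: connected_induce_subgraph_iff[OF sym])
  qed
  moreover have "insert x (N x) \<subseteq> {..<n}" if "x < n" for x using that N[of x] by auto
  ultimately show ?thesis using tree by (auto simp: tree_decomposition_def)
qed

section \<open>The blown-up tree\<close>

text \<open>
  The vertex \<open>p * t + i\<close> with \<open>i < t\<close> is the \<open>i\<close>-th vertex of the clique that replaces the node \<open>p\<close>
  of a tree whose parent function is \<open>p div 4\<close>. It is joined to the earlier vertices of its own
  clique and to the vertices of the parent clique with index at least \<open>i\<close>.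
\<close>

definition back_nbrs :: "nat \<Rightarrow> nat \<Rightarrow> nat set" where
  "back_nbrs t v = {w. w < v \<and>
     (w div t = v div t \<or> w div t = v div t div 4 \<and> v mod t \<le> w mod t)}"

text \<open>For positive \<open>t\<close> and \<open>v\<close> this is the largest element of
  \<open>back_nbrs t v\<close>; it serves as the parent of \<open>v\<close> in the decomposition
  tree.\<close>

definition pred_vertex :: "nat \<Rightarrow> nat \<Rightarrow> nat" where
  "pred_vertex t v = (if v mod t = 0 then (v div t div 4) * t + (t - 1) else v - 1)"

lemma back_nbrs_subset: "back_nbrs t v \<subseteq> {..<v}"
  by (auto simp: back_nbrs_def)

lemma less_same_div:
  fixes v w :: nat
  assumes "w < v" "w div t = v div t"
  shows "w mod t < v mod t"
  using assms by (metis add_less_cancel_left div_mult_mod_eq)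

text \<open>Earlier neighbours in the own clique have index below \<open>v mod t\<close>, those in a
  different parent clique have index at least \<open>v mod t\<close>. Hence the index determines the
  neighbour.\<close>

lemma card_back_nbrs_le:
  assumes "0 < t"
  shows "card (back_nbrs t v) \<le> t"
proof -
  have "inj_on (\<lambda>w. w mod t) (back_nbrs t v)"
  proof (rule inj_onI)
    fix x y assume x: "x \<in> back_nbrs t v" and y: "y \<in> back_nbrs t v" and xy: "x mod t = y mod t"
    have "x div t = y div t"
      using x y xy less_same_div[of x v t] less_same_div[of y v t]
      by (auto simp: back_nbrs_def)
    with xy show "x = y" by (metis div_mult_mod_eq)
  qed
  moreover have "(\<lambda>w. w mod t) ` back_nbrs t v \<subseteq> {..<t}" using assms by auto
  ultimately have "card (back_nbrs t v) \<le> card {..<t}" by (rule card_inj_on_le) simp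
  then show ?thesis by simp
qed

lemma div_mod_block:
  fixes t :: nat
  assumes "i < t"
  shows "(p * t + i) div t = p" "(p * t + i) mod t = i"
  using assms by auto

text \<open>For index 0 all earlier neighbours lie in the parent clique, whose last vertex is the
  predecessor. Otherwise the predecessor is in the same clique with index one lower, so its
  threshold in the parent clique is weaker and only the predecessor itself is lost.\<close>

lemma pred_vertex_props:
  assumes "0 < t" "0 < v"
  shows "pred_vertex t v < v \<and>
    back_nbrs t v \<subseteq> insert (pred_vertex t v) (back_nbrs t (pred_vertex t v))"
proof (cases "v mod t = 0")
  case True
  define p where "p = v div t"
  have v: "v = p * t" using True by (auto simp: p_def)
  with assms have p: "p div 4 < p" by simp
  let ?u = "(p div 4) * t + (t - 1)"
  have u: "pred_vertex t v = ?u" using True by (simp add: pred_vertex_def p_def)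
  have u_div: "?u div t = p div 4" using assms by (intro div_mod_block) simp
  have "?u < Suc (p div 4) * t" using assms by simp
  also have "\<dots> \<le> v" unfolding v using p by (intro mult_right_mono) auto
  finally have "?u < v" .
  moreover have "w \<in> insert ?u (back_nbrs t ?u)" if w: "w \<in> back_nbrs t v" for w
  proof -
    have "w div t < p" using w v assms by (simp add: back_nbrs_def less_mult_imp_div_less)
    then have w_div: "w div t = p div 4" using w by (auto simp: back_nbrs_def p_def)
    then have "w = (p div 4) * t + w mod t" by (metis div_mult_mod_eq)
    moreover have "w mod t \<le> t - 1" using assms by (simp add: Suc_leI less_Suc_eq_le[symmetric])
    ultimately have "w \<le> ?u" by linarith
    then show ?thesis using w_div u_div by (auto simp: back_nbrs_def)
  qed
  ultimately show ?thesis unfolding u by blast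
next
  case False
  define u where "u = v - 1"
  have v: "v = Suc u" using assms by (simp add: u_def)
  have m: "Suc (u mod t) = v mod t" "u div t = v div t"
    using False unfolding v by (auto simp: mod_Suc div_Suc split: if_splits)
  have "pred_vertex t v = u" using False by (simp add: pred_vertex_def u_def)
  moreover have "w \<in> insert u (back_nbrs t u)" if "w \<in> back_nbrs t v" for w
    using that m by (auto simp: back_nbrs_def v less_Suc_eq)
  ultimately show ?thesis using v by auto
qed

text \<open>The tree nodes below \<open>4 ^ h\<close> are the base-4 numerals with at most
  \<open>h\<close> digits, and taking the parent drops the last digit. The power of 4 keeps the
  final vertex count simple.\<close>

abbreviation blowup :: "nat \<Rightarrow> nat \<Rightarrow> nat pair_pre_digraph" where
  "blowup t h \<equiv> back_graph (4 ^ h * t) (back_nbrs t)"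

lemma treewidth_blowup:
  assumes "0 < t" "0 < h"
  shows "treewidth (blowup t h) = t"
proof (rule antisym)
  let ?G = "blowup t h"
  have td: "tree_decomposition ?G (parent_tree (4 ^ h * t) (pred_vertex t))
      (\<lambda>v. insert v (back_nbrs t v))"
    using assms pred_vertex_props back_nbrs_subset
    by (intro back_graph_tree_decomposition) auto
  have "card (insert v (back_nbrs t v)) \<le> Suc t" for v
    using card_back_nbrs_le[OF assms(1), of v] finite_subset[OF back_nbrs_subset finite_lessThan]
    by (simp add: card_insert_if)
  then show "treewidth ?G \<le> t" by (rule treewidth_le[OF td])
  show "t \<le> treewidth ?G"
  proof (rule treewidth_ge[OF td])
    fix T :: "nat pair_pre_digraph" and B assume T: "tree_decomposition ?G T B"
    \<comment> \<open>Vertex \<open>t\<close> has index 0 in the clique of node 1, so it is joined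
      to the whole root clique and \<open>{..t}\<close> is a clique. Node 1 exists because
      \<open>h\<close> is positive.\<close>
    have adj: "v \<in> back_nbrs t w" if "v < w" "w \<le> t" for v w
      using that by (cases "w = t") (auto simp: back_nbrs_def)
    have "t < 4 * t" using assms(1) by simp
    also have "\<dots> \<le> 4 ^ h * t"
      using assms(2) by (intro mult_right_mono) (auto intro: self_le_power)
    finally have n: "t < 4 ^ h * t" .
    obtain x where x: "x \<in> pverts T" "{..t} \<subseteq> B x"
    proof (rule tree_decomposition_clique_bag[OF T])
      show "(v, w) \<in> parcs ?G" if "v \<in> {..t}" "w \<in> {..t}" "v \<noteq> w" for v w
      proof -
        have "v < 4 ^ h * t" "w < 4 ^ h * t" using that n by (meson atMost_iff order_le_less_trans)+
        then show ?thesis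
          using that adj[of v w] adj[of w v] by (cases v w rule: linorder_cases) simp_all
      qed
      show "{..t} \<subseteq> pverts ?G" using n by (auto intro: order_le_less_trans)
    qed auto
    have "finite (B x)" using T x(1) by (auto simp: tree_decomposition_def intro: finite_subset)
    then have "card {..t} \<le> card (B x)" using x(2) by (rule card_mono)
    with x(1) show "\<exists>x\<in>pverts T. t < card (B x)" by (auto simp: Suc_le_eq)
  qed
qed

section \<open>Ternary subtrees\<close>

text \<open>The digit 0 is left out because for \<open>p = 0\<close> the node \<open>4 * p\<close>
  is the root itself.\<close>

fun ternary_nodes :: "nat \<Rightarrow> nat \<Rightarrow> nat set" where
  "ternary_nodes 0 p = {p}"
| "ternary_nodes (Suc k) p = insert p (\<Union>a\<in>{1, 2, 3}. ternary_nodes k (4 * p + a))"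

lemma finite_ternary_nodes: "finite (ternary_nodes k p)"
  by (induction k arbitrary: p) auto

lemma root_in_ternary_nodes: "p \<in> ternary_nodes k p"
  by (cases k) auto

lemma ternary_nodes_div: "q \<in> ternary_nodes k p \<Longrightarrow> \<exists>d. q div 4 ^ d = p"
proof (induction k arbitrary: p)
  case 0
  then show ?case by (intro exI[of _ 0]) simp
next
  case (Suc k)
  show ?case
  proof (cases "q = p")
    case True
    then show ?thesis by (intro exI[of _ 0]) simp
  next
    case False
    then obtain a where a: "a \<in> {1, 2, 3}" "q \<in> ternary_nodes k (4 * p + a)"
      using Suc.prems unfolding ternary_nodes.simps by blast
    then obtain d where "q div 4 ^ d = 4 * p + a" using Suc.IH by blast
    then have "q div 4 ^ Suc d = p" using a(1) by (auto simp: div_mult2_eq mult.commute[of 4])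
    then show ?thesis ..
  qed
qed

lemma ternary_nodes_less: "q \<in> ternary_nodes k p \<Longrightarrow> q < 4 ^ k * Suc p"
proof (induction k arbitrary: p)
  case (Suc k)
  show ?case
  proof (cases "q = p")
    case False
    then obtain a where a: "a \<in> {1, 2, 3}" "q \<in> ternary_nodes k (4 * p + a)"
      using Suc.prems unfolding ternary_nodes.simps by blast
    then have "q < 4 ^ k * Suc (4 * p + a)" using Suc.IH by blast
    also have "\<dots> \<le> 4 ^ k * (4 * Suc p)" using a(1) by (intro mult_left_mono) auto
    finally show ?thesis by (simp add: algebra_simps)
  next
    case True
    have "1 * Suc p \<le> 4 ^ Suc k * Suc p" by (intro mult_right_mono) auto
    with True show ?thesis by simp
  qed
qed simp

text \<open>A common node would have both \<open>4 * p + a\<close> and \<open>4 * p + b\<close> as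
  ancestors. These differ, so one would be a proper ancestor of the other and thus at most
  \<open>p\<close>, which is too small.\<close>

lemma ternary_nodes_disjoint:
  assumes ab: "a \<in> {1, 2, 3}" "b \<in> {1, 2, 3}" "a \<noteq> b"
  shows "ternary_nodes k (4 * p + a) \<inter> ternary_nodes l (4 * p + b) = {}"
proof -
  have *: False if q: "q div 4 ^ d = 4 * p + a" "q div 4 ^ (d + e) = 4 * p + b"
    and ab: "a \<in> {1, 2, 3}" "b \<in> {1, 2, 3}" "a \<noteq> b" for q d e a b :: nat
  proof (cases e)
    case 0
    then show ?thesis using q ab by simp
  next
    case (Suc e')
    have "4 * p + b = (4 * p + a) div 4 ^ e" using q by (simp add: power_add div_mult2_eq)
    also have "\<dots> = p div 4 ^ e'" using ab(1) by (auto simp: Suc div_mult2_eq)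
    also have "\<dots> \<le> p" by (rule div_le_dividend)
    finally show False using ab(2) by auto
  qed
  show ?thesis
  proof (rule ccontr)
    assume "\<not> ?thesis"
    then obtain q d e where "q div 4 ^ d = 4 * p + a" "q div 4 ^ e = 4 * p + b"
      using ternary_nodes_div by (metis disjoint_iff)
    then show False
      using *[of q d a "e - d" b] *[of q e b "d - e" a] ab by (cases d e rule: linorder_cases) auto
  qed
qed

lemma root_notin_child_nodes:
  assumes "a \<in> {1, 2, 3}"
  shows "p \<notin> ternary_nodes k (4 * p + a)"
proof
  assume "p \<in> ternary_nodes k (4 * p + a)"
  then obtain d where "p div 4 ^ d = 4 * p + a" using ternary_nodes_div by blast
  moreover have "p div 4 ^ d \<le> p" by (rule div_le_dividend)
  ultimately show False using assms by auto
qed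

lemma ternary_nodes_parent:
  "q \<in> ternary_nodes k p \<Longrightarrow> q \<noteq> p \<Longrightarrow> q div 4 \<in> ternary_nodes k p \<and> q div 4 < q"
proof (induction k arbitrary: p)
  case (Suc k)
  then obtain a where a: "a \<in> {1, 2, 3}" "q \<in> ternary_nodes k (4 * p + a)"
    unfolding ternary_nodes.simps by blast
  show ?case
  proof (cases "q = 4 * p + a")
    case True
    with a(1) show ?thesis by auto
  next
    case False
    with Suc.IH[OF a(2)] a(1) show ?thesis by auto
  qed
qed simp

lemma three_sorted:
  fixes j :: "nat \<Rightarrow> nat"
  obtains a b c where "a \<in> {1, 2, 3}" "b \<in> {1, 2, 3}" "c \<in> {1, 2, 3}" "a \<noteq> b" "b \<noteq> c"
    "j a \<le> j b" "j b \<le> j c"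
proof -
  consider "j 1 \<le> j 2" "j 2 \<le> j 3"
    | "j 1 \<le> j 3" "j 3 \<le> j 2"
    | "j 2 \<le> j 1" "j 1 \<le> j 3"
    | "j 2 \<le> j 3" "j 3 \<le> j 1"
    | "j 3 \<le> j 1" "j 1 \<le> j 2"
    | "j 3 \<le> j 2" "j 2 \<le> j 1"
    by linarith
  then show thesis
  proof cases
    case 1
    then show thesis using that[of 1 2 3] by simp
  next
    case 2
    then show thesis using that[of 1 3 2] by simp
  next
    case 3
    then show thesis using that[of 2 1 3] by simp
  next
    case 4
    then show thesis using that[of 2 3 1] by simp
  next
    case 5
    then show thesis using that[of 3 1 2] by simp
  next
    case 6
    then show thesis using that[of 3 2 1] by simp
  qed
qed

section \<open>Lower bound on the pathwidth\<close>

text \<open>One bag has to serve all columns at once. The induction on \<open>k\<close> preserves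
  this because the middle bag is selected from the positions \<open>j a\<close> alone, before a
  column is fixed.\<close>

lemma path_decomposition_dense_bag:
  assumes pd: "path_decomposition (blowup t h) P B" and "0 < t"
    and "ternary_nodes k p \<subseteq> {..<4 ^ h}"
  shows "\<exists>x\<in>pverts P. \<forall>i<t. k < card {q \<in> ternary_nodes k p. q * t + i \<in> B x}"
proof -
  let ?G = "blowup t h"
  have td: "tree_decomposition ?G P B" using pd by (simp add: path_decomposition_def)
  have sym: "sym (parcs ?G)" by (auto simp: sym_def)
  have vertex: "q * t + i < 4 ^ h * t" if "q < 4 ^ h" "i < t" for q i
  proof -
    have "q * t + i < Suc q * t" using that by simp
    also have "\<dots> \<le> 4 ^ h * t" using that by (intro mult_right_mono) auto
    finally show ?thesis .
  qed
  obtain xs where xs: "pverts P = set xs"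
    and cross: "\<And>C u v i k j. (u, v) \<in> (Restr (parcs ?G) C)\<^sup>* \<Longrightarrow> C \<subseteq> pverts ?G \<Longrightarrow>
      u \<in> C \<inter> B (xs ! i) \<Longrightarrow> v \<in> C \<inter> B (xs ! j) \<Longrightarrow> i \<le> k \<Longrightarrow> k \<le> j \<Longrightarrow> j < length xs \<Longrightarrow>
      C \<inter> B (xs ! k) \<noteq> {}"
    using path_decomposition_sequence[OF pd] by blast
  have "\<exists>j<length xs. \<forall>i<t. k < card {q \<in> ternary_nodes k p. q * t + i \<in> B (xs ! j)}"
    using assms(3)
  proof (induction k arbitrary: p)
    case 0
    then have p: "p < 4 ^ h" by simp
    \<comment> \<open>The clique of node \<open>p\<close> contains one vertex of each
      column.\<close>
    obtain x where x: "x \<in> pverts P" "(\<lambda>i. p * t + i) ` {..<t} \<subseteq> B x"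
    proof (rule tree_decomposition_clique_bag[OF td])
      show "(\<lambda>i. p * t + i) ` {..<t} \<noteq> {}" using assms(2) by auto
      fix u v assume "u \<in> (\<lambda>i. p * t + i) ` {..<t}" "v \<in> (\<lambda>i. p * t + i) ` {..<t}" "u \<noteq> v"
      then show "(u, v) \<in> parcs ?G" using vertex[OF p] by (auto simp: back_nbrs_def)
    qed (use vertex[OF p] in auto)
    have "{q \<in> ternary_nodes 0 p. q * t + i \<in> B x} = {p}" if "i < t" for i
      using x(2) that by auto
    then show ?case using x(1) xs by (auto simp: in_set_conv_nth)
  next
    case (Suc k)
    have "\<forall>a\<in>{1, 2, 3}. \<exists>j. j < length xs \<and>
        (\<forall>i<t. k < card {q \<in> ternary_nodes k (4 * p + a). q * t + i \<in> B (xs ! j)})"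
    proof
      fix a :: nat assume "a \<in> {1, 2, 3}"
      then have "ternary_nodes k (4 * p + a) \<subseteq> {..<4 ^ h}"
        using Suc.prems unfolding ternary_nodes.simps by blast
      then show "\<exists>j. j < length xs \<and>
          (\<forall>i<t. k < card {q \<in> ternary_nodes k (4 * p + a). q * t + i \<in> B (xs ! j)})"
        by (rule Suc.IH)
    qed
    from bchoice[OF this] obtain j where J: "\<forall>a\<in>{1, 2, 3}. j a < length xs \<and>
        (\<forall>i<t. k < card {q \<in> ternary_nodes k (4 * p + a). q * t + i \<in> B (xs ! j a)})" ..
    have j: "j a < length xs" if "a \<in> {1, 2, 3}" for a
      using bspec[OF J that] by (rule conjunct1)
    have dense: "k < card {q \<in> ternary_nodes k (4 * p + a). q * t + i \<in> B (xs ! j a)}"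
      if "a \<in> {1, 2, 3}" "i < t" for a i
      using bspec[OF J that(1)] that(2) by (elim conjE allE impE)
    obtain a b c where abc: "a \<in> {1, 2, 3}" "b \<in> {1, 2, 3}" "c \<in> {1, 2, 3}" "a \<noteq> b" "b \<noteq> c"
      and le: "j a \<le> j b" "j b \<le> j c"
      using three_sorted[of j] by blast
    have "Suc k < card {q \<in> ternary_nodes (Suc k) p. q * t + i \<in> B (xs ! j b)}" if i: "i < t" for i
    proof -
      \<comment> \<open>The root and the two outer subtrees; \<open>C\<close> is their copy in
        column \<open>i\<close>.\<close>
      define M where
        "M = insert p (ternary_nodes k (4 * p + a) \<union> ternary_nodes k (4 * p + c))"
      define C where "C = (\<lambda>q. q * t + i) ` M"
      have child_sub: "ternary_nodes k (4 * p + d) \<subseteq> ternary_nodes (Suc k) p"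
        if "d \<in> {1, 2, 3}" for d
        using that unfolding ternary_nodes.simps by blast
      have M_sub: "M \<subseteq> ternary_nodes (Suc k) p"
        using child_sub[OF abc(1)] child_sub[OF abc(3)] root_in_ternary_nodes by (simp add: M_def)
      have M_parent: "q div 4 \<in> M \<and> q div 4 < q" if "q \<in> M" "q \<noteq> p" for q
      proof -
        from that obtain d where ac: "d = a \<or> d = c" and q: "q \<in> ternary_nodes k (4 * p + d)"
          unfolding M_def by blast
        have d: "d \<in> {1, 2, 3}" using ac abc(1,3) by metis
        have sub: "ternary_nodes k (4 * p + d) \<subseteq> M" using ac unfolding M_def by blast
        show ?thesis
        proof (cases "q = 4 * p + d")
          case True
          with d show ?thesis by (auto simp: M_def)
        next
          case False
          then show ?thesis using ternary_nodes_parent[OF q] sub by blast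
        qed
      qed
      have "M \<subseteq> {..<4 ^ h}" using M_sub Suc.prems by (rule order_trans)
      then have C_sub: "C \<subseteq> pverts ?G" using vertex i by (auto simp: C_def)
      \<comment> \<open>Climbing to the parent node within column \<open>i\<close>; the arc exists
        because equal indices meet the threshold in \<open>back_nbrs\<close>.\<close>
      define f where "f v = (v div t div 4) * t + i" for v
      have conn: "(u, v) \<in> (Restr (parcs ?G) C)\<^sup>*" if "u \<in> C" "v \<in> C" for u v
        using sym _ that
      proof (rule rtrancl_to_root[where f = f and a = "p * t + i"])
        fix v assume v: "v \<in> C" "v \<noteq> p * t + i"
        then obtain q where q: "q \<in> M" "v = q * t + i" "q \<noteq> p" unfolding C_def by blast
        have fv: "f (q * t + i) = (q div 4) * t + i" using i by (simp add: f_def)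
        have "f v < v" unfolding q(2) fv using M_parent[OF q(1,3)] assms(2) by simp
        moreover have "f v \<in> C" unfolding q(2) fv C_def using M_parent[OF q(1,3)] by blast
        moreover have "f v div t = v div t div 4" "f v mod t = v mod t"
          unfolding q(2) fv using i by simp_all
        then have "f v \<in> back_nbrs t v" using \<open>f v < v\<close> by (simp add: back_nbrs_def)
        ultimately show "(v, f v) \<in> parcs ?G \<and> f v \<in> C \<and> f v < v"
          using v(1) C_sub by auto
      qed
      have meets: "\<exists>u. u \<in> C \<inter> B (xs ! j d)" if ac: "d = a \<or> d = c" for d
      proof -
        have "d \<in> {1, 2, 3}" using ac abc(1,3) by metis
        from dense[OF this i]
        have "card {q \<in> ternary_nodes k (4 * p + d). q * t + i \<in> B (xs ! j d)} \<noteq> 0" by linarith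
        then have "{q \<in> ternary_nodes k (4 * p + d). q * t + i \<in> B (xs ! j d)} \<noteq> {}"
          by (metis card.empty)
        then show ?thesis using ac unfolding C_def M_def by blast
      qed
      obtain u v where u: "u \<in> C \<inter> B (xs ! j a)" and v: "v \<in> C \<inter> B (xs ! j c)"
        using meets by blast
      \<comment> \<open>The connected set \<open>C\<close> meets the two outer bags, hence also the
        middle one.\<close>
      have "C \<inter> B (xs ! j b) \<noteq> {}"
        by (rule cross[OF conn[OF IntD1[OF u] IntD1[OF v]] C_sub u v le j[OF abc(3)]])
      then obtain q where q: "q \<in> M" "q * t + i \<in> B (xs ! j b)" by (auto simp: C_def)
      let ?F = "{q \<in> ternary_nodes k (4 * p + b). q * t + i \<in> B (xs ! j b)}"
      \<comment> \<open>So \<open>q\<close> is new to the middle subtree and raises its count in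
        this column by one.\<close>
      have "q \<notin> ternary_nodes k (4 * p + b)"
        using q(1) ternary_nodes_disjoint[OF abc(1,2,4)] root_notin_child_nodes[OF abc(2)]
          ternary_nodes_disjoint[OF abc(3,2) abc(5)[symmetric]]
        unfolding M_def by blast
      then have "Suc k < card (insert q ?F)"
        using dense[OF abc(2) i] finite_ternary_nodes by (simp add: card_insert_if)
      also have "\<dots> \<le> card {q \<in> ternary_nodes (Suc k) p. q * t + i \<in> B (xs ! j b)}"
      proof (rule card_mono)
        show "finite {q \<in> ternary_nodes (Suc k) p. q * t + i \<in> B (xs ! j b)}"
          by (rule finite_subset[OF Collect_restrict finite_ternary_nodes])
        show "insert q ?F \<subseteq> {q \<in> ternary_nodes (Suc k) p. q * t + i \<in> B (xs ! j b)}"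
          using q M_sub child_sub[OF abc(2)] by blast
      qed
      finally show ?thesis .
    qed
    then show ?case using j abc(2) by blast
  qed
  then show ?thesis using xs by auto
qed

text \<open>Column \<open>i\<close> is the residue class of \<open>i\<close> modulo
  \<open>t\<close>, so different columns are disjoint and their counts add up.\<close>

lemma card_ge_if_columns:
  assumes "finite D" and col: "\<And>i. i < t \<Longrightarrow> m \<le> card {q. q * t + i \<in> D}"
  shows "t * m \<le> card (D :: nat set)"
proof -
  have col': "card {q. q * t + i \<in> D} \<le> card {v \<in> D. v mod t = i}" if "i < t" for i
  proof (rule card_inj_on_le[where f = "\<lambda>q. q * t + i"])
    show "inj_on (\<lambda>q. q * t + i) {q. q * t + i \<in> D}" using that by (auto simp: inj_on_def)
  qed (use assms(1) that in auto)
  have "t * m = (\<Sum>i<t. m)" by simp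
  also have "\<dots> \<le> (\<Sum>i<t. card {v \<in> D. v mod t = i})"
    using order_trans[OF col col'] by (intro sum_mono) simp
  also have "\<dots> = card (\<Union>i<t. {v \<in> D. v mod t = i})"
    using assms(1) by (intro card_UN_disjoint[symmetric]) auto
  also have "\<dots> \<le> card D" using assms(1) by (intro card_mono) auto
  finally show ?thesis .
qed

lemma pathwidth_blowup:
  assumes "0 < t"
  shows "t * (h + 1) - 1 \<le> pathwidth (blowup t h)"
proof (rule pathwidth_ge)
  show "pair_graph (blowup t h)" using back_nbrs_subset by (rule pair_graph_back_graph)
  fix P :: "nat pair_pre_digraph" and B assume pd: "path_decomposition (blowup t h) P B"
  have "ternary_nodes h 0 \<subseteq> {..<4 ^ h}" using ternary_nodes_less[of _ h 0] by auto
  then obtain x where x: "x \<in> pverts P" "\<forall>i<t. h < card {q \<in> ternary_nodes h 0. q * t + i \<in> B x}"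
    using path_decomposition_dense_bag[OF pd assms] by blast
  have "B x \<subseteq> {..<4 ^ h * t}"
    using pd x(1) by (auto simp: path_decomposition_def tree_decomposition_def)
  then have fin: "finite (B x)" by (rule finite_subset) simp
  have "h + 1 \<le> card {q. q * t + i \<in> B x}" if "i < t" for i
  proof -
    have "finite ((\<lambda>q. q * t + i) -` B x)"
      using fin assms by (intro finite_vimageI) (auto simp: inj_def)
    then have "card {q \<in> ternary_nodes h 0. q * t + i \<in> B x} \<le> card {q. q * t + i \<in> B x}"
      by (intro card_mono) (auto simp: vimage_def)
    with x(2) that show ?thesis by fastforce
  qed
  then have "t * (h + 1) \<le> card (B x)" by (rule card_ge_if_columns[OF fin])
  with x(1) show "\<exists>x\<in>pverts P. t * (h + 1) \<le> card (B x)" ..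
qed

text \<open>With \<open>l\<close> the rounded logarithm, \<open>t \<le> 2 ^ l\<close>. The factor 3
  arises from \<open>2 * (h + 1) + l\<close>: two shares pay for the power of 4 and one for
  \<open>t\<close>.\<close>

lemma blowup_card_less:
  assumes "0 < t"
  shows "4 ^ h * t < 2 ^ (3 * max (h + 1) (nat \<lceil>log 2 (real t)\<rceil>))"
proof -
  define l where "l = nat \<lceil>log 2 (real t)\<rceil>"
  have "real t = 2 powr log 2 (real t)" using assms by simp
  also have "\<dots> \<le> 2 powr real l" unfolding l_def by (intro powr_mono) linarith+
  also have "\<dots> = real (2 ^ l)" by (simp add: powr_realpow)
  finally have "t \<le> 2 ^ l" by linarith
  then have "4 ^ h * t < 4 ^ (h + 1) * 2 ^ l"
    using assms by (intro mult_less_le_imp_less) auto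
  also have "\<dots> = 2 ^ (2 * (h + 1) + l)"
    by (simp only: power_add power_mult) simp
  also have "\<dots> \<le> 2 ^ (3 * max (h + 1) l)"
    by (intro power_increasing) (auto simp: max_def)
  finally show ?thesis by (simp only: l_def)
qed

theorem theorem16:
  fixes t h :: nat
  assumes "t > 0" and "h > 0"
  shows "\<exists>G :: nat pair_pre_digraph. pair_graph G \<and>
    treewidth G = t \<and>
    pathwidth G \<ge> t * (h + 1) - 1 \<and>
    \<not> contains_subdivision_of_complete_binary_tree G (3 * max (h + 1) (nat \<lceil>log 2 (real t)\<rceil>))"
proof (intro exI conjI)
  show "pair_graph (blowup t h)" using back_nbrs_subset by (rule pair_graph_back_graph)
  show "treewidth (blowup t h) = t" using assms by (rule treewidth_blowup)
  show "pathwidth (blowup t h) \<ge> t * (h + 1) - 1" using assms(1) by (rule pathwidth_blowup)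
  show "\<not> contains_subdivision_of_complete_binary_tree (blowup t h)
      (3 * max (h + 1) (nat \<lceil>log 2 (real t)\<rceil>))"
  proof
    assume "contains_subdivision_of_complete_binary_tree (blowup t h)
      (3 * max (h + 1) (nat \<lceil>log 2 (real t)\<rceil>))"
    from card_ge_if_contains_subdivision[OF this] blowup_card_less[OF assms(1), of h]
    show False by simp
  qed
qed

end
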